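(* Let $m\in\mathbb{N}$, $d\ge2$, $\eta=(0,\dots,0,-1)\in\mathbb{R}^d$, and for $\varepsilon>0$ let $$\mathcal{F}^*_{\varepsilon,m}(x):=\frac{2^{2m-2}(d/2)_{m-1}}{m!}\,\frac{\varepsilon^{2m-1}}{|x-\varepsilon\eta|^{2m+d-2}},\quad x\in\mathbb{R}^{d-1},$$ and $$F^*_{\varepsilon,m}(x):=\mathcal{F}^*_{\varepsilon,m}(x)\Big(\int_{\mathbb{R}^{d-1}}\mathcal{F}^*_{\varepsilon,m}(y)\,dy\Big)^{-1},\quad x\in\mathbb{R}^{d-1}.$$ Then $F^*_{\varepsilon,m}$ is a summability kernel, i.e. $\int_{\mathbb{R}^{d-1}}F^*_{\varepsilon,m}(x)\,dx=1$, with the decay $$0<F^*_{\varepsilon,m}(x)\le\frac{c\,\varepsilon^{-d+1}}{(1+\varepsilon^{-1}|x|)^{2m+d-2}}\quad\text{for all }x\in\mathbb{R}^{d-1}\text{ and }\varepsilon>0,$$ where $c>0$ depends only on $m$ and $d$, and $F^*_{\varepsilon,m}$ can be represented on $\mathbb{R}^{d-1}$ as a linear combination of the functions $\partial_d^\ell|x-\varepsilon\eta|^{2-d}$, $\ell=1,\dots,m$, if $d>2$, or of the functions $\partial_d^\ell\ln\frac{1}{|x-\varepsilon\eta|}$, $\ell=1,\dots,m$, if $d=2$.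
   Context: $|\cdot|$ is the Euclidean norm on $\mathbb{R}^d$. $\mathbb{R}^{d-1}$ is identified with the subspace $\{x\in\mathbb{R}^d: x=(x_1,\dots,x_{d-1},0)\}$ of $\mathbb{R}^d$, with $dx=dx_1\dots dx_{d-1}$. $\partial_d$ is the partial derivative with respect to $x_d$ (applied to functions on $\mathbb{R}^d\setminus\{\varepsilon\eta\}$ and then restricted to $\mathbb{R}^{d-1}$). $(u)_0:=1$, $(u)_k:=u(u+1)\cdots(u+k-1)$ is the Pochhammer symbol. *)

theory Defs
  imports "HOL-Analysis.Analysis"
begin

text \<open>
  The space of dimension \<open>d \<ge> 2\<close> is modelled as \<open>(real ^ 'n) \<times> real\<close>, whose product norm is the
  Euclidean norm; the second component is the coordinate \<open>x\<^sub>d\<close> and \<open>d = CARD('n) + 1\<close>. Since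
  \<open>CARD('n) \<ge> 1\<close> is arbitrary, every \<open>d \<ge> 2\<close> occurs. The hyperplane \<open>x\<^sub>d = 0\<close> is parametrised by
  \<open>real ^ 'n\<close>, with \<open>dx\<close> being \<open>lborel\<close> there.
\<close>

type_synonym 'n space = "(real ^ 'n) \<times> real"

definition hyp :: "real ^ 'n::finite \<Rightarrow> 'n space" where
  "hyp x = (x, 0)"

definition eta :: "'n::finite space" where
  "eta = (0, - 1)"

text \<open>
  The value at a point where \<open>f\<close> is not differentiable in direction \<open>x\<^sub>d\<close> is unspecified. For the
  functions used below this concerns only the singularity \<open>\<epsilon> \<eta>\<close>, which is off the hyperplane.
\<close>

definition partial_d :: "('n::finite space \<Rightarrow> real) \<Rightarrow> 'n space \<Rightarrow> real" where
  "partial_d f p = deriv (\<lambda>t. f (fst p, t)) (snd p)"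

text \<open>
  For \<open>m \<ge> 1\<close> and \<open>d \<ge> 2\<close> none of the subtractions on natural numbers below truncates.
\<close>

definition Fcal :: "nat \<Rightarrow> real \<Rightarrow> real ^ 'n::finite \<Rightarrow> real" where
  "Fcal m \<epsilon> x = (let d = DIM('n space) in
     2 ^ (2 * m - 2) * pochhammer (real d / 2) (m - 1) / fact m *
     (\<epsilon> ^ (2 * m - 1) / norm (hyp x - \<epsilon> *\<^sub>R eta) ^ (2 * m + d - 2)))"

definition Fstar :: "nat \<Rightarrow> real \<Rightarrow> real ^ 'n::finite \<Rightarrow> real" where
  "Fstar m \<epsilon> x = Fcal m \<epsilon> x * inverse (LINT y|lborel. Fcal m \<epsilon> (y :: real ^ 'n))"

end

theory Submission
  imports Defs
begin

text \<open>
  On the hyperplane the distance to \<open>\<epsilon> \<eta>\<close> is \<open>norm (x, \<epsilon>)\<close>, so up to a positive constant \<open>Fcal\<close> is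
  \<open>\<epsilon> ^ (2m-1) / norm (x, \<epsilon>) ^ (2m+d-2)\<close>. Since \<open>2m+d-2 > d-1\<close>, it is integrable, and positivity
  makes its integral nonzero, which gives the normalisation. The integral does not depend on \<open>\<epsilon>\<close>:
  the substitution \<open>y = \<epsilon> z\<close> produces the power \<open>\<epsilon> ^ (d-1)\<close> that cancels the homogeneity of the
  kernel (\<open>integral_Fcal_eq\<close>). With \<open>\<epsilon> + norm x \<le> 2 norm (x, \<epsilon>)\<close>, this yields the decay
  estimate with a constant depending on \<open>m\<close> and \<open>d\<close> only.

  For the representation, put \<open>q = 2 - d\<close> and \<open>H j = norm (x, s) powi (q-2-2j)\<close>, with \<open>s = t + \<epsilon>\<close>.
  In both cases the first normal derivative of the given function is \<open>\<kappa> s H 0\<close> with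
  \<open>\<kappa> \<noteq> 0\<close> (\<open>\<kappa> = q\<close> for the power, \<open>\<kappa> = -1\<close> for the logarithm), and the derivative of \<open>H j\<close>
  in \<open>s\<close> is \<open>(q-2-2j) s H (j+1)\<close>. Hence the derivative of order \<open>l+1\<close> is a combination of
  \<open>H 0, \<dots>, H l\<close> whose coefficients are polynomials in \<open>s\<close> alone, not in \<open>x\<close>, and the coefficient of
  \<open>H l\<close> is a nonzero monomial because \<open>q \<le> 0\<close> (\<open>partial_d_iterates_expansion\<close>). At \<open>s = \<epsilon>\<close> this is a
  triangular system with nonzero diagonal. Solving it (\<open>triangular_inversion\<close>) expresses
  \<open>H (m-1) = norm (x, \<epsilon>) powi (2-d-2m)\<close>, a multiple of the kernel, by the first \<open>m\<close> derivatives.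
\<close>

section \<open>Integrability and scaling\<close>

text \<open>
  The function is dominated by a sum of multiples of indicators of the balls of radius \<open>2 ^ k\<close>,
  whose integrals decay geometrically.
\<close>

lemma integrable_inverse_power_one_plus_norm:
  assumes "N > DIM('a::euclidean_space)"
  shows "integrable lborel (\<lambda>x::'a. 1 / (1 + norm x) ^ N)"
proof (rule integrableI_nonneg)
  define V where "V = unit_ball_vol (real DIM('a))"
  have V: "V \<ge> 0" unfolding V_def by (simp add: unit_ball_vol_nonneg)
  let ?g = "\<lambda>k x. ennreal (2 ^ N * (1 / 2 ^ k) ^ N) * indicator (cball 0 (2 ^ k)) (x::'a)"
  show "(\<lambda>x::'a. 1 / (1 + norm x) ^ N) \<in> borel_measurable lborel" by measurable
  show "AE x::'a in lborel. 0 \<le> 1 / (1 + norm x) ^ N" by simp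
  have pt: "ennreal (1 / (1 + norm x) ^ N) \<le> (\<Sum>k. ?g k x)" for x :: 'a
  proof -
    \<comment> \<open>For the least such \<open>k\<close>, \<open>1 + norm x\<close> is comparable to \<open>2 ^ k\<close>.\<close>
    define k where "k = (LEAST k::nat. norm x \<le> 2 ^ k)"
    have ex: "\<exists>k::nat. norm x \<le> 2 ^ k"
      using real_arch_pow[of 2 "norm x"] by (auto intro: less_imp_le)
    have k: "norm x \<le> 2 ^ k" unfolding k_def using ex by (rule LeastI_ex)
    have lower: "2 ^ k \<le> 2 * (1 + norm x)"
    proof (cases k)
      case 0
      then show ?thesis by (simp add: add_increasing2)
    next
      case (Suc j)
      then have "\<not> norm x \<le> 2 ^ j" unfolding k_def by (metis lessI not_less_Least)
      then show ?thesis using Suc by simp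
    qed
    have "1 / (1 + norm x) \<le> 2 * (1 / 2 ^ k)"
      using lower by (simp add: divide_simps add_pos_nonneg)
    then have "(1 / (1 + norm x)) ^ N \<le> (2 * (1 / 2 ^ k)) ^ N"
      by (intro power_mono) auto
    then have "ennreal (1 / (1 + norm x) ^ N) \<le> ?g k x"
      using k by (auto simp: power_mult_distrib power_divide intro!: ennreal_leI)
    also have "\<dots> = (\<Sum>i\<in>{k}. ?g i x)"
      by (simp only: sum.insert sum.empty finite.emptyI empty_iff not_False_eq_True add_0_right)
    also have "\<dots> \<le> (\<Sum>k. ?g k x)" by (rule sum_le_suminf) auto
    finally show ?thesis .
  qed
  have "(\<integral>\<^sup>+x. ennreal (1 / (1 + norm x) ^ N) \<partial>(lborel::'a measure))
      \<le> (\<integral>\<^sup>+x. (\<Sum>k. ?g k x) \<partial>lborel)"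
    by (intro nn_integral_mono pt)
  also have "\<dots> = (\<Sum>k. \<integral>\<^sup>+x. ?g k x \<partial>lborel)"
    by (rule nn_integral_suminf)
      (auto intro!: borel_measurable_times_ennreal borel_measurable_indicator)
  also have "\<dots> = (\<Sum>k. ennreal (2 ^ N * (1 / 2 ^ k) ^ N * (V * (2 ^ k) ^ DIM('a))))"
    using V by (simp add: nn_integral_cmult_indicator emeasure_cball V_def[symmetric] ennreal_mult)
  also have "\<dots> \<le> (\<Sum>k. ennreal (2 ^ N * V * (1 / 2) ^ k))"
  proof (intro suminf_le ennreal_leI)
    fix k :: nat
    \<comment> \<open>The exponent \<open>N\<close> exceeds the dimension by at least 1.\<close>
    have "(2::real) ^ k * (2 ^ k) ^ DIM('a) \<le> (2 ^ k) ^ N"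
      unfolding power_Suc[symmetric] using assms by (intro power_increasing) auto
    then have "(1 / 2 ^ k) ^ N * (2 ^ k) ^ DIM('a) \<le> (1 / 2 ^ k :: real)"
      by (simp add: divide_simps power_divide mult.commute)
    then have "(2 ^ N * V) * ((1 / 2 ^ k) ^ N * (2 ^ k) ^ DIM('a)) \<le> 2 ^ N * V * (1 / 2 ^ k)"
      using V by (intro mult_left_mono) auto
    then show "2 ^ N * (1 / 2 ^ k) ^ N * (V * (2 ^ k) ^ DIM('a)) \<le> 2 ^ N * V * (1 / 2) ^ k"
      by (simp add: mult_ac power_divide)
  qed auto
  also have "\<dots> < \<infinity>"
    using V by (subst suminf_ennreal2) (auto intro!: summable_mult summable_geometric)
  finally show "(\<integral>\<^sup>+x. ennreal (1 / (1 + norm x) ^ N) \<partial>(lborel::'a measure)) < \<infinity>" .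
qed

lemma integral_lborel_scaleR:
  fixes f :: "'a::euclidean_space \<Rightarrow> real"
  assumes [measurable]: "f \<in> borel_measurable borel" and "c \<noteq> 0"
  shows "(LINT x|lborel. f x) = \<bar>c\<bar> ^ DIM('a) * (LINT x|lborel. f (c *\<^sub>R x))"
proof -
  have "(LINT x|lborel. f x)
      = (LINT x|density (distr lborel borel (\<lambda>x::'a. 0 + c *\<^sub>R x))
          (\<lambda>_. ennreal (\<bar>c\<bar> ^ DIM('a))). f x)"
    using lborel_affine[OF assms(2), of "0::'a"] by (simp add: ennreal_power)
  also have "\<dots> = \<bar>c\<bar> ^ DIM('a) * (LINT x|lborel. f (c *\<^sub>R x))"
    by (subst integral_density) (auto simp: integral_distr)
  finally show ?thesis .
qed

lemma integral_lborel_pos: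
  fixes f :: "'a::euclidean_space \<Rightarrow> real"
  assumes f: "integrable lborel f" and pos: "\<And>x. f x > 0"
  shows "(LINT x|lborel. f x) > 0"
proof -
  have "\<not> (AE x::'a in lborel. False)"
    using ae_filter_eq_bot_iff[of "lborel :: 'a measure"] by (simp add: trivial_limit_def)
  then have "(LINT x|lborel. f x) \<noteq> 0"
    using pos by (subst integral_nonneg_eq_0_iff_AE[OF f])
      (auto simp: less_imp_le less_imp_neq[symmetric])
  moreover have "(LINT x|lborel. f x) \<ge> 0"
    using pos by (intro Bochner_Integration.integral_nonneg) (simp add: less_imp_le)
  ultimately show ?thesis by simp
qed

section \<open>The kernel on the hyperplane\<close>

lemma norm_Pair_pos:
  fixes x :: "'a::real_normed_vector" and s :: real
  assumes "s > 0"
  shows "norm (x, s) > 0"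
  using assms by (simp add: zero_prod_def)

text \<open>The factor of \<open>Fcal\<close> that depends on \<open>m\<close> and the dimension \<open>d\<close> only.\<close>

definition kernel_const :: "nat \<Rightarrow> nat \<Rightarrow> real" where
  "kernel_const m d = 2 ^ (2 * m - 2) * pochhammer (real d / 2) (m - 1) / fact m"

lemma kernel_const_pos: "d > 0 \<Longrightarrow> kernel_const m d > 0"
  by (auto simp: kernel_const_def intro!: mult_pos_pos divide_pos_pos pochhammer_pos)

lemma hyp_minus_eta: "hyp x - \<epsilon> *\<^sub>R eta = (x, \<epsilon>)"
  by (simp add: hyp_def eta_def)

lemma Fcal_eq:
  fixes x :: "real ^ 'n::finite"
  assumes "d = DIM('n space)"
  shows "Fcal m \<epsilon> x = kernel_const m d * (\<epsilon> ^ (2 * m - 1) / norm (x, \<epsilon>) ^ (2 * m + d - 2))"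
  by (simp add: Fcal_def kernel_const_def hyp_minus_eta assms Let_def)

lemma one_plus_norm_le:
  fixes x :: "'a::real_normed_vector"
  assumes "\<epsilon> > 0"
  shows "\<epsilon> * (1 + norm x / \<epsilon>) \<le> 2 * norm (x, \<epsilon>)"
proof -
  have "norm x \<le> norm (x, \<epsilon>)" "\<bar>\<epsilon>\<bar> \<le> norm (x, \<epsilon>)"
    by (auto simp: norm_Pair intro!: real_le_rsqrt)
  then show ?thesis using assms by (simp add: distrib_left)
qed

lemma Fcal_pos:
  fixes x :: "real ^ 'n::finite"
  assumes "\<epsilon> > 0"
  shows "Fcal m \<epsilon> x > 0"
proof -
  have "norm (x, \<epsilon>) > 0" by (rule norm_Pair_pos[OF assms])
  then show ?thesis
    unfolding Fcal_eq[OF refl] using assms kernel_const_pos[of "DIM('n space)" m]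
    by (intro mult_pos_pos divide_pos_pos zero_less_power) auto
qed

lemma Fcal_le:
  fixes x :: "real ^ 'n::finite"
  assumes "\<epsilon> > 0" "m \<ge> 1" and d: "d = DIM('n space)"
  shows "Fcal m \<epsilon> x \<le> kernel_const m d * 2 ^ (2 * m + d - 2) * \<epsilon> powi (1 - int d)
    / (1 + norm x / \<epsilon>) ^ (2 * m + d - 2)"
proof -
  define N where "N = 2 * m + d - 2"
  have d2: "d \<ge> 1" using d by simp
  have pos: "norm (x, \<epsilon>) > 0" and pos': "1 + norm x / \<epsilon> > 0"
    using assms(1) by (auto intro: add_pos_nonneg norm_Pair_pos simp del: zero_less_norm_iff)
  have "(\<epsilon> * (1 + norm x / \<epsilon>)) ^ N \<le> (2 * norm (x, \<epsilon>)) ^ N"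
    using assms(1) one_plus_norm_le[of \<epsilon> x] by (intro power_mono) auto
  then have 1: "1 / norm (x, \<epsilon>) ^ N \<le> 2 ^ N / (\<epsilon> ^ N * (1 + norm x / \<epsilon>) ^ N)"
    using pos pos' assms(1) zero_less_power[of "norm (x, \<epsilon>)" N]
      zero_less_power[of "\<epsilon> * (1 + norm x / \<epsilon>)" N]
    by (simp only: power_mult_distrib[symmetric])
      (simp add: power_mult_distrib pos_le_divide_eq pos_divide_le_eq mult_ac)
  have "int (2 * m - 1) - int N = 1 - int d" using assms(2) d2 by (simp add: N_def of_nat_diff)
  then have 2: "\<epsilon> ^ (2 * m - 1) / \<epsilon> ^ N = \<epsilon> powi (1 - int d)"
    using assms(1) power_int_diff[of \<epsilon> "int (2 * m - 1)" "int N"] by simp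
  have "Fcal m \<epsilon> x = kernel_const m d * \<epsilon> ^ (2 * m - 1) * (1 / norm (x, \<epsilon>) ^ N)"
    by (simp add: Fcal_eq[OF d] N_def)
  also have "\<dots> \<le> kernel_const m d * \<epsilon> ^ (2 * m - 1) * (2 ^ N / (\<epsilon> ^ N * (1 + norm x / \<epsilon>) ^ N))"
    using assms(1) d2 kernel_const_pos[of d m] by (intro mult_left_mono 1) auto
  also have "\<dots> = kernel_const m d * 2 ^ N * (\<epsilon> ^ (2 * m - 1) / \<epsilon> ^ N) / (1 + norm x / \<epsilon>) ^ N"
    by simp
  finally show ?thesis unfolding N_def[symmetric] 2 .
qed

lemma borel_measurable_Fcal [measurable]:
  "(Fcal m \<epsilon> :: real ^ 'n::finite \<Rightarrow> real) \<in> borel_measurable borel"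
  unfolding Fcal_eq[OF refl] norm_Pair by measurable

text \<open>
  The exponents satisfy \<open>2m+d-2 = (2m-1) + (d-1)\<close>, so scaling the argument by \<open>\<epsilon>\<close> leaves the integral
  unchanged. The identity holds before integrability is known.
\<close>

lemma integral_Fcal_eq:
  assumes "\<epsilon> > 0" "m \<ge> 1"
  shows "(LINT y|lborel. Fcal m \<epsilon> (y :: real ^ 'n::finite))
    = (LINT y|lborel. Fcal m 1 (y :: real ^ 'n))"
proof -
  define N where "N = 2 * m + DIM('n space) - 2"
  have N: "N = (2 * m - 1) + DIM(real ^ 'n)" using assms(2) by (simp add: N_def)
  have "\<bar>\<epsilon>\<bar> ^ DIM(real ^ 'n) * Fcal m \<epsilon> (\<epsilon> *\<^sub>R y) = Fcal m 1 y" for y :: "real ^ 'n"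
  proof -
    have "norm (\<epsilon> *\<^sub>R y, \<epsilon>) = norm (\<epsilon> *\<^sub>R (y, 1::real))" by simp
    also have "\<dots> = \<epsilon> * norm (y, 1::real)" using assms(1) by (simp only: norm_scaleR abs_of_pos)
    finally show ?thesis
      using assms(1)
      unfolding Fcal_eq[OF refl] N_def[symmetric]
      by (simp add: power_mult_distrib N power_add field_simps)
  qed
  then show ?thesis
    using assms(1)
    by (simp add: integral_lborel_scaleR[of "Fcal m \<epsilon>" \<epsilon>] flip: integral_mult_right_zero)
qed

lemma integrable_Fcal:
  assumes "\<epsilon> > 0" "m \<ge> 1"
  shows "integrable lborel (Fcal m \<epsilon> :: real ^ 'n::finite \<Rightarrow> real)"
proof -
  define N where "N = 2 * m + DIM('n space) - 2"
  define C where "C = kernel_const m DIM('n space) * 2 ^ N"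
  have 1: "integrable lborel (Fcal m 1 :: real ^ 'n \<Rightarrow> real)"
  proof (rule Bochner_Integration.integrable_bound)
    have "integrable lborel (\<lambda>x::real ^ 'n. 1 / (1 + norm x) ^ N)"
      by (rule integrable_inverse_power_one_plus_norm) (use assms(2) in \<open>simp add: N_def\<close>)
    then show "integrable lborel (\<lambda>x::real ^ 'n. C * (1 / (1 + norm x) ^ N))"
      by (rule integrable_mult_right)
    show "AE x::real ^ 'n in lborel. norm (Fcal m 1 x) \<le> norm (C * (1 / (1 + norm x) ^ N))"
    proof (rule AE_I2)
      fix x :: "real ^ 'n"
      have "0 < Fcal m 1 x" by (simp add: Fcal_pos)
      moreover have "Fcal m 1 x \<le> C * (1 / (1 + norm x) ^ N)"
        using Fcal_le[OF _ assms(2) refl, of 1 x] by (simp add: C_def N_def)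
      ultimately show "norm (Fcal m 1 x) \<le> norm (C * (1 / (1 + norm x) ^ N))"
        unfolding real_norm_def by linarith
    qed
  qed simp
  have "integral\<^sup>L lborel (Fcal m 1 :: real ^ 'n \<Rightarrow> real) \<noteq> 0"
    using integral_lborel_pos[OF 1 Fcal_pos] by simp
  \<comment> \<open>The integral of a function that is not integrable is 0.\<close>
  then show ?thesis
    using integral_Fcal_eq[OF assms, where 'n = 'n] not_integrable_integral_eq by metis
qed

lemma integral_Fcal_pos:
  assumes "\<epsilon> > 0" "m \<ge> 1"
  shows "(LINT y|lborel. Fcal m \<epsilon> (y :: real ^ 'n::finite)) > 0"
  by (intro integral_lborel_pos integrable_Fcal Fcal_pos assms)

section \<open>Normal derivatives of the fundamental solution\<close>

text \<open>The positivity of \<open>s\<close> keeps the point away from the singularity, even for \<open>x = 0\<close>.\<close>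

lemma has_field_derivative_norm_Pair_powi:
  fixes x :: "'a::real_normed_vector" and q :: int
  assumes "s > 0"
  shows "((\<lambda>s. norm (x, s) powi q) has_field_derivative
    real_of_int q * s * norm (x, s) powi (q - 2)) (at s)"
proof -
  have pos: "(norm x)\<^sup>2 + s\<^sup>2 > 0" using assms by (simp add: add_nonneg_pos)
  have "((\<lambda>s. norm (x, s)) has_field_derivative s / norm (x, s)) (at s)"
    unfolding norm_Pair using pos
    by (auto intro!: derivative_eq_intros simp: field_simps)
  then have "((\<lambda>s. norm (x, s) powi q) has_field_derivative
      real_of_int q * norm (x, s) powi (q - 1) * (s / norm (x, s))) (at s)"
    using norm_Pair_pos[OF assms, of x] by (intro DERIV_power_int disjI2) auto
  moreover have "norm (x, s) powi (q - 1) / norm (x, s) = norm (x, s) powi (q - 2)"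
    using norm_Pair_pos[OF assms, of x] power_int_diff[of "norm (x, s)" "q - 1" 1] by simp
  ultimately show ?thesis by (metis (no_types, lifting) mult.assoc mult.commute times_divide_eq_right)
qed

text \<open>
  The polynomials \<open>c j\<close> do not depend on \<open>x\<close>. That \<open>c l\<close> is a nonzero monomial survives the induction
  because each step multiplies it by \<open>(q - 2 - 2l) s\<close>, and \<open>q - 2 - 2l < 0\<close>.
\<close>

lemma partial_d_iterates_expansion:
  fixes f :: "'n::finite space \<Rightarrow> real" and q :: int
  assumes base: "\<And>x t. t > - \<epsilon> \<Longrightarrow>
      partial_d f (x, t) = \<kappa> * (t + \<epsilon>) * norm (x, t + \<epsilon>) powi (q - 2)"
    and "\<kappa> \<noteq> 0" "q \<le> 0"
  shows "\<exists>c. (\<exists>A. A \<noteq> 0 \<and> c l = monom A (Suc l)) \<and> (\<forall>j>l. c j = 0) \<and>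
    (\<forall>x t. t > - \<epsilon> \<longrightarrow> (partial_d ^^ Suc l) f (x, t)
      = (\<Sum>j\<le>l. poly (c j) (t + \<epsilon>) * norm (x, t + \<epsilon>) powi (q - 2 - 2 * int j)))"
proof (induction l)
  case 0
  show ?case
    using assms(2) base
    by (intro exI[of _ "\<lambda>j. if j = 0 then monom \<kappa> 1 else 0"]) (auto simp: poly_monom)
next
  case (Suc l)
  then obtain c A where A: "A \<noteq> 0" "c l = monom A (Suc l)" and c0: "\<forall>j>l. c j = 0"
    and c: "\<And>x t. t > - \<epsilon> \<Longrightarrow> (partial_d ^^ Suc l) f (x, t)
      = (\<Sum>j\<le>l. poly (c j) (t + \<epsilon>) * norm (x, t + \<epsilon>) powi (q - 2 - 2 * int j))"
    by blast
  define r where "r j = q - 2 - 2 * int j" for j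
  have r_Suc: "r (Suc j) = r j - 2" for j by (simp add: r_def)
  define c' where "c' j = pderiv (c j)
      + (case j of 0 \<Rightarrow> 0 | Suc i \<Rightarrow> smult (real_of_int (r i)) (pCons 0 (c i)))" for j
  have top: "c' (Suc l) = monom (real_of_int (r l) * A) (Suc (Suc l))"
    using c0 A(2) by (simp add: c'_def smult_monom monom_Suc[symmetric])
  have rl: "real_of_int (r l) * A \<noteq> 0" using A(1) assms(3) by (simp add: r_def)
  have "(partial_d ^^ Suc (Suc l)) f (x, t)
      = (\<Sum>j\<le>Suc l. poly (c' j) (t + \<epsilon>) * norm (x, t + \<epsilon>) powi r j)"
    if t: "t > - \<epsilon>" for x t
  proof -
    define s where "s = t + \<epsilon>"
    have s: "s > 0" using t by (simp add: s_def)
    have "((\<lambda>s. \<Sum>j\<le>l. poly (c j) s * norm (x, s) powi r j) has_field_derivative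
        (\<Sum>j\<le>l. poly (pderiv (c j)) s * norm (x, s) powi r j
          + poly (c j) s * (real_of_int (r j) * s * norm (x, s) powi (r j - 2)))) (at s)"
      by (intro DERIV_sum DERIV_cong[OF DERIV_mult[OF poly_DERIV
            has_field_derivative_norm_Pair_powi[OF s]]]) (simp add: mult_ac)
    also have "(\<Sum>j\<le>l. poly (pderiv (c j)) s * norm (x, s) powi r j
          + poly (c j) s * (real_of_int (r j) * s * norm (x, s) powi (r j - 2)))
        = (\<Sum>j\<le>Suc l. poly (c' j) s * norm (x, s) powi r j)"
    proof -
      have "(\<Sum>j\<le>Suc l. poly (c' j) s * norm (x, s) powi r j)
          = (\<Sum>j\<le>Suc l. poly (pderiv (c j)) s * norm (x, s) powi r j)
          + (\<Sum>j\<le>Suc l. poly (case j of 0 \<Rightarrow> 0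
              | Suc i \<Rightarrow> smult (real_of_int (r i)) (pCons 0 (c i))) s * norm (x, s) powi r j)"
        by (simp only: c'_def poly_add distrib_right sum.distrib)
      also have "(\<Sum>j\<le>Suc l. poly (pderiv (c j)) s * norm (x, s) powi r j)
          = (\<Sum>j\<le>l. poly (pderiv (c j)) s * norm (x, s) powi r j)"
        using c0 by simp
      also have "(\<Sum>j\<le>Suc l. poly (case j of 0 \<Rightarrow> 0
              | Suc i \<Rightarrow> smult (real_of_int (r i)) (pCons 0 (c i))) s * norm (x, s) powi r j)
          = (\<Sum>j\<le>l. poly (c j) s * (real_of_int (r j) * s * norm (x, s) powi (r j - 2)))"
        by (subst sum.atMost_Suc_shift) (simp add: r_Suc mult_ac)
      finally show ?thesis by (simp add: sum.distrib)
    qed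
    finally have "((\<lambda>t. \<Sum>j\<le>l. poly (c j) (t + \<epsilon>) * norm (x, t + \<epsilon>) powi r j)
        has_field_derivative (\<Sum>j\<le>Suc l. poly (c' j) s * norm (x, s) powi r j)) (at t)"
      unfolding s_def by (simp only: DERIV_shift)
    \<comment> \<open>The expansion is known only above the singular height, but on an open set of heights.\<close>
    then have "((\<lambda>t. (partial_d ^^ Suc l) f (x, t)) has_field_derivative
        (\<Sum>j\<le>Suc l. poly (c' j) s * norm (x, s) powi r j)) (at t)"
      by (rule has_field_derivative_transform_within_open[where S = "{- \<epsilon><..}"])
        (use t c in \<open>auto simp: r_def\<close>)
    then show ?thesis by (simp add: partial_d_def DERIV_imp_deriv s_def)
  qed
  moreover have "\<forall>j>Suc l. c' j = 0"
    using c0 by (auto simp: c'_def split: nat.split)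
  ultimately show ?case using top rl unfolding r_def by blast
qed

lemma triangular_inversion:
  fixes D H :: "nat \<Rightarrow> 'a \<Rightarrow> real"
  assumes D: "\<And>l x. l < m \<Longrightarrow> D l x = (\<Sum>j\<le>l. c l j * H j x)"
    and diag: "\<And>l. l < m \<Longrightarrow> c l l \<noteq> 0"
    and "l < m"
  shows "\<exists>a. \<forall>x. H l x = (\<Sum>i<m. a i * D i x)"
  using \<open>l < m\<close>
proof (induction l rule: less_induct)
  case (less l)
  then obtain b where b: "\<And>j x. j < l \<Longrightarrow> H j x = (\<Sum>i<m. b j i * D i x)"
    by (metis less_trans)
  show ?case
  proof (intro exI allI)
    fix x
    have "c l l * H l x = D l x - (\<Sum>j<l. c l j * H j x)"
      using D[OF less.prems, of x] by (simp flip: lessThan_Suc_atMost)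
    also have "D l x = (\<Sum>i<m. of_bool (i = l) * D i x)"
      using less.prems by (simp add: of_bool_def if_distrib[of "\<lambda>u. u * _"] sum.delta cong: if_cong)
    also have "(\<Sum>j<l. c l j * H j x) = (\<Sum>i<m. (\<Sum>j<l. c l j * b j i) * D i x)"
      by (simp add: b sum_distrib_left sum_distrib_right mult.assoc) (rule sum.swap)
    finally have "c l l * H l x = (\<Sum>i<m. (of_bool (i = l) - (\<Sum>j<l. c l j * b j i)) * D i x)"
      by (simp add: left_diff_distrib sum_subtractf)
    then have "H l x = (\<Sum>i<m. (of_bool (i = l) - (\<Sum>j<l. c l j * b j i)) * D i x) / c l l"
      using diag[OF less.prems] by (simp add: field_simps)
    also have "\<dots> = (\<Sum>i<m. (of_bool (i = l) - (\<Sum>j<l. c l j * b j i)) / c l l * D i x)"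
      by (simp add: sum_divide_distrib)
    finally show "H l x = (\<Sum>i<m. (of_bool (i = l) - (\<Sum>j<l. c l j * b j i)) / c l l * D i x)" .
  qed
qed

text \<open>
  The sum over derivatives of orders \<open>1, \<dots>, m\<close> is the triangular system of size \<open>m\<close> with indices
  shifted by one: the row \<open>i < m\<close> belongs to the derivative of order \<open>i + 1\<close>.
\<close>

lemma powi_norm_in_span_of_partial_d_iterates:
  fixes f :: "'n::finite space \<Rightarrow> real" and q :: int
  assumes base: "\<And>x t. t > - \<epsilon> \<Longrightarrow>
      partial_d f (x, t) = \<kappa> * (t + \<epsilon>) * norm (x, t + \<epsilon>) powi (q - 2)"
    and "\<kappa> \<noteq> 0" "q \<le> 0" "\<epsilon> > 0" "m \<ge> 1"
  shows "\<exists>a. \<forall>x. norm (x, \<epsilon>) powi (q - 2 * int m) = (\<Sum>l = 1..m. a l * (partial_d ^^ l) f (hyp x))"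
proof -
  have "\<forall>l. \<exists>c. (\<exists>A. A \<noteq> 0 \<and> c l = monom A (Suc l)) \<and> (\<forall>j>l. c j = 0) \<and>
    (\<forall>x t. t > - \<epsilon> \<longrightarrow> (partial_d ^^ Suc l) f (x, t)
      = (\<Sum>j\<le>l. poly (c j) (t + \<epsilon>) * norm (x, t + \<epsilon>) powi (q - 2 - 2 * int j)))"
    by (intro allI partial_d_iterates_expansion[of \<epsilon> f \<kappa> q, OF base assms(2,3)])
  from choice[OF this] obtain c where
    diag: "\<And>l. \<exists>A. A \<noteq> 0 \<and> c l l = monom A (Suc l)"
    and c: "\<And>l x t. t > - \<epsilon> \<Longrightarrow> (partial_d ^^ Suc l) f (x, t)
      = (\<Sum>j\<le>l. poly (c l j) (t + \<epsilon>) * norm (x, t + \<epsilon>) powi (q - 2 - 2 * int j))"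
    by blast
  have "\<exists>a. \<forall>x::real ^ 'n. norm (x, \<epsilon>) powi (q - 2 - 2 * int (m - 1))
      = (\<Sum>i<m. a i * (partial_d ^^ Suc i) f (hyp x))"
  proof (rule triangular_inversion[where c = "\<lambda>l j. poly (c l j) \<epsilon>" and l = "m - 1"
        and D = "\<lambda>l x. (partial_d ^^ Suc l) f (hyp x)"
        and H = "\<lambda>j x. norm (x, \<epsilon>) powi (q - 2 - 2 * int j)"])
    fix l and x :: "real ^ 'n"
    show "(partial_d ^^ Suc l) f (hyp x)
        = (\<Sum>j\<le>l. poly (c l j) \<epsilon> * norm (x, \<epsilon>) powi (q - 2 - 2 * int j))"
      using c[of 0 l x] assms(4) by (simp add: hyp_def)
    show "poly (c l l) \<epsilon> \<noteq> 0" using diag[of l] assms(4) by (auto simp: poly_monom)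
  qed (use assms(5) in simp)
  then obtain a where a: "\<And>x::real ^ 'n. norm (x, \<epsilon>) powi (q - 2 - 2 * int (m - 1))
      = (\<Sum>i<m. a i * (partial_d ^^ Suc i) f (hyp x))" by blast
  have m: "q - 2 - 2 * int (m - 1) = q - 2 * int m" using assms(5) by (simp add: of_nat_diff)
  show ?thesis
    using a unfolding m
    by (intro exI[of _ "\<lambda>l. a (l - 1)"]) (simp add: sum.atLeast1_atMost_eq del: funpow.simps)
qed

lemma partial_d_powi_norm:
  assumes "t > - \<epsilon>"
  shows "partial_d (\<lambda>y. norm (y - \<epsilon> *\<^sub>R eta) powi q) (x, t)
    = real_of_int q * (t + \<epsilon>) * norm (x, t + \<epsilon>) powi (q - 2)"
proof -
  have "((\<lambda>t. norm (x, t + \<epsilon>) powi q) has_field_derivative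
      real_of_int q * (t + \<epsilon>) * norm (x, t + \<epsilon>) powi (q - 2)) (at t)"
    using has_field_derivative_norm_Pair_powi[of "t + \<epsilon>" x q] assms by (simp only: DERIV_shift)
  then show ?thesis by (simp add: partial_d_def eta_def DERIV_imp_deriv)
qed

text \<open>The logarithm plays the role of the power with exponent \<open>q = 0\<close>, with \<open>\<kappa> = -1\<close> instead of \<open>q\<close>.\<close>

lemma partial_d_ln_norm:
  assumes "t > - \<epsilon>"
  shows "partial_d (\<lambda>y. ln (1 / norm (y - \<epsilon> *\<^sub>R eta))) (x, t)
    = - 1 * (t + \<epsilon>) * norm (x, t + \<epsilon>) powi (0 - 2)"
proof -
  have pos: "norm (x, t + \<epsilon>) > 0" using assms by (intro norm_Pair_pos) simp
  \<comment> \<open>\<open>1 / norm\<close> is the power with exponent \<open>- 1\<close>, to which the chain rule for \<open>ln\<close> applies.\<close>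
  have "((\<lambda>t. norm (x, t + \<epsilon>) powi (- 1)) has_field_derivative
      - 1 * (t + \<epsilon>) * norm (x, t + \<epsilon>) powi (- 3)) (at t)"
    using has_field_derivative_norm_Pair_powi[of "t + \<epsilon>" x "- 1"] assms
    by (simp only: DERIV_shift) simp
  from DERIV_chain2[OF DERIV_ln_divide this] pos
  have "((\<lambda>t. ln (1 / norm (x, t + \<epsilon>))) has_field_derivative
      1 / norm (x, t + \<epsilon>) powi (- 1) * (- 1 * (t + \<epsilon>) * norm (x, t + \<epsilon>) powi (- 3))) (at t)"
    by (simp add: power_int_minus inverse_eq_divide)
  also have "1 / norm (x, t + \<epsilon>) powi (- 1) * (- 1 * (t + \<epsilon>) * norm (x, t + \<epsilon>) powi (- 3))
      = - 1 * (t + \<epsilon>) * norm (x, t + \<epsilon>) powi (0 - 2)"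
    using pos by (simp add: power_int_minus field_simps eval_nat_numeral)
  finally show ?thesis by (simp add: partial_d_def eta_def DERIV_imp_deriv)
qed

lemma Fstar_in_span_of_partial_d_iterates:
  fixes f :: "'n::finite space \<Rightarrow> real"
  assumes d: "d = DIM('n space)" and "\<epsilon> > 0" "m \<ge> 1" "\<kappa> \<noteq> 0"
    and base: "\<And>x t. t > - \<epsilon> \<Longrightarrow>
      partial_d f (x, t) = \<kappa> * (t + \<epsilon>) * norm (x, t + \<epsilon>) powi ((2 - int d) - 2)"
  shows "\<exists>a. \<forall>x :: real ^ 'n. Fstar m \<epsilon> x = (\<Sum>l = 1..m. a l * (partial_d ^^ l) f (hyp x))"
proof -
  have d2: "d \<ge> 2" using d by (simp add: Suc_le_eq)
  obtain a where a: "\<And>x. norm (x, \<epsilon>) powi (2 - int d - 2 * int m)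
      = (\<Sum>l = 1..m. a l * (partial_d ^^ l) f (hyp x))"
    using powi_norm_in_span_of_partial_d_iterates[of \<epsilon> f \<kappa> "2 - int d" m, OF base] assms(2-4) d2
    by auto
  define K where "K = kernel_const m d * \<epsilon> ^ (2 * m - 1)
      * inverse (LINT y|lborel. Fcal m \<epsilon> (y :: real ^ 'n))"
  have "Fstar m \<epsilon> x = (\<Sum>l = 1..m. K * a l * (partial_d ^^ l) f (hyp x))" for x :: "real ^ 'n"
  proof -
    have e: "2 - int d - 2 * int m = - int (2 * m + d - 2)" using d2 by (simp add: of_nat_diff)
    have "Fstar m \<epsilon> x = K * norm (x, \<epsilon>) powi (2 - int d - 2 * int m)"
      unfolding e by (simp add: Fstar_def Fcal_eq[OF d] K_def power_int_minus field_simps)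
    then show ?thesis by (simp add: a sum_distrib_left mult.assoc)
  qed
  then show ?thesis by (intro exI[of _ "\<lambda>l. K * a l"]) simp
qed

section \<open>The summability kernel\<close>

theorem corollary6p2:
  fixes m d :: nat
  assumes "m \<ge> 1"
    and "d = DIM('n::finite space)"
  shows "(\<forall>\<epsilon>>0. (LINT x|lborel. Fstar m \<epsilon> (x :: real ^ 'n)) = 1)
    \<and> (\<exists>c>0. \<forall>\<epsilon>>0. \<forall>x :: real ^ 'n.
          0 < Fstar m \<epsilon> x
        \<and> Fstar m \<epsilon> x \<le> c * \<epsilon> powi (1 - int d) / (1 + inverse \<epsilon> * norm (hyp x)) ^ (2 * m + d - 2))
    \<and> (d > 2 \<longrightarrow> (\<forall>\<epsilon>>0. \<exists>a :: nat \<Rightarrow> real. \<forall>x :: real ^ 'n.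
          Fstar m \<epsilon> x = (\<Sum>l = 1..m. a l *
            (partial_d ^^ l) (\<lambda>y. norm (y - \<epsilon> *\<^sub>R eta) powi (2 - int d)) (hyp x))))
    \<and> (d = 2 \<longrightarrow> (\<forall>\<epsilon>>0. \<exists>a :: nat \<Rightarrow> real. \<forall>x :: real ^ 'n.
          Fstar m \<epsilon> x = (\<Sum>l = 1..m. a l *
            (partial_d ^^ l) (\<lambda>y. ln (1 / norm (y - \<epsilon> *\<^sub>R eta))) (hyp x))))"
proof (intro conjI impI allI)
  fix \<epsilon> :: real assume e: "\<epsilon> > 0"
  show "(LINT x|lborel. Fstar m \<epsilon> (x :: real ^ 'n)) = 1"
    unfolding Fstar_def using integral_Fcal_pos[OF e assms(1), where 'n = 'n] by simp
next
  define I where "I = (LINT y|lborel. Fcal m 1 (y :: real ^ 'n))"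
  define C where "C = kernel_const m d * 2 ^ (2 * m + d - 2) * inverse I"
  have I: "I > 0" unfolding I_def using integral_Fcal_pos[OF _ assms(1), of 1] by simp
  have C: "C > 0" using kernel_const_pos[of d m] I assms(2) by (simp add: C_def)
  have Fstar: "Fstar m \<epsilon> x = Fcal m \<epsilon> x * inverse I" if "\<epsilon> > 0" for \<epsilon> and x :: "real ^ 'n"
    using integral_Fcal_eq[OF that assms(1), where 'n = 'n] by (simp add: Fstar_def I_def)
  have "0 < Fstar m \<epsilon> x
      \<and> Fstar m \<epsilon> x \<le> C * \<epsilon> powi (1 - int d) / (1 + inverse \<epsilon> * norm (hyp x)) ^ (2 * m + d - 2)"
    if e: "\<epsilon> > 0" for \<epsilon> and x :: "real ^ 'n"
  proof -
    have n: "inverse \<epsilon> * norm (hyp x) = norm x / \<epsilon>"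
      by (simp add: hyp_def field_simps)
    show ?thesis
      using Fcal_pos[OF e, of m x] I
        mult_right_mono[OF Fcal_le[OF e assms(1,2), of x], of "inverse I"]
      unfolding n Fstar[OF e] C_def by (simp add: mult_ac)
  qed
  with C show "\<exists>c>0. \<forall>\<epsilon>>0. \<forall>x :: real ^ 'n. 0 < Fstar m \<epsilon> x
      \<and> Fstar m \<epsilon> x \<le> c * \<epsilon> powi (1 - int d) / (1 + inverse \<epsilon> * norm (hyp x)) ^ (2 * m + d - 2)"
    by blast
next
  fix \<epsilon> :: real assume "d > 2" "\<epsilon> > 0"
  then show "\<exists>a. \<forall>x :: real ^ 'n. Fstar m \<epsilon> x = (\<Sum>l = 1..m. a l *
      (partial_d ^^ l) (\<lambda>y. norm (y - \<epsilon> *\<^sub>R eta) powi (2 - int d)) (hyp x))"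
    by (intro Fstar_in_span_of_partial_d_iterates[OF assms(2) _ assms(1) _ partial_d_powi_norm]) auto
next
  fix \<epsilon> :: real assume "d = 2" "\<epsilon> > 0"
  then show "\<exists>a. \<forall>x :: real ^ 'n. Fstar m \<epsilon> x = (\<Sum>l = 1..m. a l *
      (partial_d ^^ l) (\<lambda>y. ln (1 / norm (y - \<epsilon> *\<^sub>R eta))) (hyp x))"
    by (intro Fstar_in_span_of_partial_d_iterates[OF assms(2) _ assms(1), of _ "- 1"])
      (simp_all only: partial_d_ln_norm, simp_all)
qed

end
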